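(* Let $k\ge 1$ be an integer and let $\mathbb{K}$ be a finite field such that $\operatorname{char}(\mathbb{K})\nmid k$, $\operatorname{char}(\mathbb{K})\nmid k+1$ and $|\mathbb{K}|=q$. Then the total number of $n\times n$ upper triangular $(k+1)$-potent matrices in $T_n(\mathbb{K})$ with elements of the set $D=\{0,1,\omega,\omega^2,\ldots,\omega^{k-1}\}$ on the diagonal, where $\omega$ is a $k$th root of unity in $\mathbb{K}$, is equal to $$\sum_{\substack{n_0+\cdots+n_k=n\\ 0\le n_i}}\binom{n}{n_0,n_1,n_2,\ldots,n_k}\cdot q^{\sum_{0\le i<j\le k} n_i n_j},\qquad\text{where}\quad \binom{n}{n_0,\ldots,n_k}=\frac{n!}{n_0!\,n_1!\cdots n_k!}.$$
   Context: $T_n(\mathbb{K})$ denotes the ring of $n\times n$ upper triangular matrices over $\mathbb{K}$. A matrix $A$ is called $(k+1)$-potent if $A^{k+1}=A$. A $k$th root of unity is an element $\omega$ with $\omega^k=1$. The outer sum runs over all $(k+1)$-tuples $(n_0,\ldots,n_k)$ of nonnegative integers with sum $n$.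
   Formalization: Here ω is required to be a primitive kth root of unity, so that 0, 1, ω, …, ω^{k−1} are distinct; for an arbitrary kth root of unity the formula fails (k=2, q=5, ω=1, n=1: there are 2 matrices, but the formula gives 3). *)

theory Defs
  imports "Jordan_Normal_Form.Matrix"
begin

definition potent_mat :: "nat \<Rightarrow> 'a::semiring_1 mat \<Rightarrow> bool" where
  "potent_mat m A \<longleftrightarrow> A ^\<^sub>m m = A"

definition upper_triangular_mats :: "nat \<Rightarrow> 'a::zero mat set" where
  "upper_triangular_mats n = {A \<in> carrier_mat n n. upper_triangular A}"

definition root_of_unity :: "nat \<Rightarrow> 'a::monoid_mult \<Rightarrow> bool" where
  "root_of_unity k w \<longleftrightarrow> w ^ k = 1"

(* Primitivity is what makes 0, 1, w, ..., w ^ (k - 1) pairwise distinct.  Without it the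
   count below is false: for k = 2, q = 5, n = 1, w = 1 there are 2 matrices instead of 3. *)
definition primitive_root_of_unity :: "nat \<Rightarrow> 'a::monoid_mult \<Rightarrow> bool" where
  "primitive_root_of_unity k w \<longleftrightarrow>
     root_of_unity k w \<and> (\<forall>j. 0 < j \<and> j < k \<longrightarrow> \<not> root_of_unity j w)"

definition diag_values :: "nat \<Rightarrow> 'a::semiring_1 \<Rightarrow> 'a set" where
  "diag_values k w = insert 0 {w ^ i |i. i < k}"

definition weak_compositions :: "nat \<Rightarrow> nat \<Rightarrow> nat list set" where
  "weak_compositions m n = {ns. length ns = m \<and> sum_list ns = n}"

definition multinomial :: "nat list \<Rightarrow> nat" where
  "multinomial ns = fact (sum_list ns) div (\<Prod>i<length ns. fact (ns ! i))"

(* The division in multinomial is exact. *)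
lemma prod_fact_dvd_fact_sum_list:
  "(\<Prod>i<length ns. fact (ns ! i) :: nat) dvd fact (sum_list ns)"
proof (induction ns)
  case (Cons a ns)
  have "(\<Prod>i<length (a # ns). fact ((a # ns) ! i) :: nat)
      = fact a * (\<Prod>i<length ns. fact (ns ! i))"
    by (simp add: prod.lessThan_Suc_shift del: prod.lessThan_Suc)
  also have "\<dots> dvd fact a * fact (sum_list ns)"
    using Cons.IH by (rule mult_dvd_mono[OF dvd_refl])
  also have "\<dots> dvd fact (sum_list (a # ns))"
    by (simp add: fact_fact_dvd_fact)
  finally show ?case .
qed simp

end

theory Submission
  imports Defs "Jordan_Normal_Form.Determinant" "HOL-Combinatorics.Multiset_Permutations"
begin

text \<open>Fix a diagonal $d$ with entries in $D$ and let $\Delta$ be the diagonal matrix with these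
  entries. Since $x^{k+1} - x$ splits with simple roots, every upper triangular
  $(k+1)$-potent $A$ with diagonal $d$ is conjugate to $\Delta$ by an upper unitriangular matrix,
  namely $U = (1 - A^k)(1 - \Delta^k) + \frac{1}{k} \sum_{m=1}^{k} A^m \Delta^{2k-m}$.
  So these matrices form the orbit of $\Delta$ under the unitriangular group; the stabilizer
  consists of the $U$ with $U_{ij} = 0$ whenever $d_i \neq d_j$, and the orbit has
  $q^e$ elements, where $e$ is the number of pairs $i < j$ with $d_i \neq d_j$.
  If the $a$-th element of $D$ occurs $n_a$ times in $d$, then $e = \sum_{a<b} n_a n_b$,
  and the multinomial coefficient counts the diagonals with given multiplicities.\<close>

section \<open>Products and powers of triangular matrices\<close>

lemma upper_triangular_mult:
  fixes A B :: "'a::semiring_1 mat"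
  assumes A: "A \<in> upper_triangular_mats n" and B: "B \<in> upper_triangular_mats n"
  shows "A * B \<in> upper_triangular_mats n"
    and "\<And>i. i < n \<Longrightarrow> (A * B) $$ (i, i) = A $$ (i, i) * B $$ (i, i)"
proof -
  have dim: "A \<in> carrier_mat n n" "B \<in> carrier_mat n n"
    and A0: "\<And>i j. j < i \<Longrightarrow> i < n \<Longrightarrow> A $$ (i, j) = 0"
    and B0: "\<And>i j. j < i \<Longrightarrow> i < n \<Longrightarrow> B $$ (i, j) = 0"
    using A B by (auto simp: upper_triangular_mats_def)
  have entry: "(A * B) $$ (i, j) = (\<Sum>l = 0..<n. A $$ (i, l) * B $$ (l, j))"
    if "i < n" "j < n" for i j
    using that dim by (simp add: scalar_prod_def)
  have "(A * B) $$ (i, j) = 0" if "j < i" "i < n" for i j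
  proof -
    have "A $$ (i, l) * B $$ (l, j) = 0" if "l < n" for l
      using A0[of l i] B0[of j l] that \<open>j < i\<close> \<open>i < n\<close> by (cases "l < i") auto
    then show ?thesis
      using that by (simp add: entry)
  qed
  then show "A * B \<in> upper_triangular_mats n"
    using dim by (auto simp: upper_triangular_mats_def)
  show "(A * B) $$ (i, i) = A $$ (i, i) * B $$ (i, i)" if "i < n" for i
  proof -
    have "A $$ (i, l) * B $$ (l, i) = 0" if "l \<in> {0..<n} - {i}" for l
      using A0[of l i] B0[of i l] that \<open>i < n\<close> by (cases "l < i") auto
    then have "(\<Sum>l = 0..<n. A $$ (i, l) * B $$ (l, i))
        = (\<Sum>l\<in>{i}. A $$ (i, l) * B $$ (l, i))"
      using that by (intro sum.mono_neutral_right) auto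
    then show ?thesis
      using that by (simp add: entry)
  qed
qed

lemma upper_triangular_pow:
  fixes A :: "'a::semiring_1 mat"
  assumes A: "A \<in> upper_triangular_mats n"
  shows "A ^\<^sub>m m \<in> upper_triangular_mats n"
    and "\<And>i. i < n \<Longrightarrow> (A ^\<^sub>m m) $$ (i, i) = A $$ (i, i) ^ m"
proof -
  have "A ^\<^sub>m m \<in> upper_triangular_mats n \<and>
    (\<forall>i<n. (A ^\<^sub>m m) $$ (i, i) = A $$ (i, i) ^ m)"
  proof (induction m)
    case 0
    show ?case
      using A by (auto simp: upper_triangular_mats_def)
  next
    case (Suc m)
    then show ?case
      using upper_triangular_mult[OF _ A, of "A ^\<^sub>m m"] by (simp add: power_commutes)
  qed
  then show "A ^\<^sub>m m \<in> upper_triangular_mats n"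
    and "\<And>i. i < n \<Longrightarrow> (A ^\<^sub>m m) $$ (i, i) = A $$ (i, i) ^ m"
    by auto
qed

section \<open>Matrices with free entries on a set of positions; the unitriangular group\<close>

text \<open>\<open>S\<close> is the set of free positions; elsewhere the entries are those of the
  identity. This one notion covers the unitriangular group, the centralizer of \<Delta> in it, and
  (with \<open>S\<close> the full square) all matrices.\<close>

definition unit_mats :: "nat \<Rightarrow> (nat \<times> nat) set \<Rightarrow> 'a::zero_neq_one mat set" where
  "unit_mats n S = {U \<in> carrier_mat n n.
     \<forall>i<n. \<forall>j<n. (i, j) \<notin> S \<longrightarrow> U $$ (i, j) = (if i = j then 1 else 0)}"

definition upper_pairs :: "nat \<Rightarrow> (nat \<times> nat) set" where
  "upper_pairs n = {(i, j). i < j \<and> j < n}"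

abbreviation unitriangular_mats :: "nat \<Rightarrow> 'a::zero_neq_one mat set" where
  "unitriangular_mats n \<equiv> unit_mats n (upper_pairs n)"

lemma finite_upper_pairs [simp]: "finite (upper_pairs n)"
  by (rule finite_subset[of _ "{..<n} \<times> {..<n}"]) (auto simp: upper_pairs_def)

text \<open>The free entries are coordinates. \<open>restrict\<close> makes the coordinate function
  extensional, and the inverse map fills the other positions from the identity.\<close>

lemma bij_betw_unit_mats:
  assumes "S \<subseteq> {..<n} \<times> {..<n}"
  shows "bij_betw (\<lambda>U. restrict (($$) U) S) (unit_mats n S :: 'a::zero_neq_one mat set)
    (S \<rightarrow>\<^sub>E UNIV)"
proof (rule bij_betw_byWitness[where f' = "\<lambda>f. mat n n (\<lambda>(i, j).
    if (i, j) \<in> S then f (i, j) else if i = j then 1 else 0)"])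
  show "\<forall>U\<in>unit_mats n S :: 'a mat set. mat n n (\<lambda>(i, j). if (i, j) \<in> S
      then restrict (($$) U) S (i, j) else if i = j then 1 else 0) = U"
    by (auto simp: unit_mats_def intro!: eq_matI)
  show "\<forall>f\<in>S \<rightarrow>\<^sub>E (UNIV :: 'a set). restrict (($$) (mat n n (\<lambda>(i, j). if (i, j) \<in> S then f (i, j)
      else if i = j then 1 else 0))) S = f"
  proof (intro ballI ext)
    fix f :: "nat \<times> nat \<Rightarrow> 'a" and p
    assume "f \<in> S \<rightarrow>\<^sub>E UNIV"
    then show "restrict (($$) (mat n n (\<lambda>(i, j). if (i, j) \<in> S then f (i, j)
      else if i = j then 1 else 0))) S p = f p"
      using assms by (cases p) (auto simp: PiE_def extensional_def)
  qed
qed (auto simp: unit_mats_def)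

lemma card_unit_mats:
  assumes "S \<subseteq> {..<n} \<times> {..<n}"
  shows "card (unit_mats n S :: 'a::{zero_neq_one,finite} mat set) = card (UNIV :: 'a set) ^ card S"
proof -
  have "finite S"
    using assms by (rule finite_subset) simp
  then show ?thesis
    using bij_betw_same_card[OF bij_betw_unit_mats[OF assms, where 'a = 'a]] by (simp add: card_funcsetE)
qed

lemma finite_unit_mats:
  assumes "S \<subseteq> {..<n} \<times> {..<n}"
  shows "finite (unit_mats n S :: 'a::{zero_neq_one,finite} mat set)"
proof -
  have "finite S"
    using assms by (rule finite_subset) simp
  then show ?thesis
    using bij_betw_finite[OF bij_betw_unit_mats[OF assms, where 'a = 'a]] by (simp add: finite_PiE)
qed

lemma upper_pairs_subset: "upper_pairs n \<subseteq> {..<n} \<times> {..<n}"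
  by (auto simp: upper_pairs_def)

lemma unitriangular_iff:
  "U \<in> unitriangular_mats n \<longleftrightarrow>
   U \<in> upper_triangular_mats n \<and> (\<forall>i<n. U $$ (i, i) = 1)"
proof
  assume "U \<in> unitriangular_mats n"
  then show "U \<in> upper_triangular_mats n \<and> (\<forall>i<n. U $$ (i, i) = 1)"
    by (auto simp: unit_mats_def upper_pairs_def upper_triangular_mats_def)
next
  assume "U \<in> upper_triangular_mats n \<and> (\<forall>i<n. U $$ (i, i) = 1)"
  then show "U \<in> unitriangular_mats n"
    by (auto simp: unit_mats_def upper_pairs_def upper_triangular_mats_def)
qed

lemma unitriangular_mult:
  fixes U V :: "'a::semiring_1 mat"
  assumes "U \<in> unitriangular_mats n" "V \<in> unitriangular_mats n"
  shows "U * V \<in> unitriangular_mats n"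
  using assms upper_triangular_mult[of U n V] by (simp add: unitriangular_iff)

text \<open>A nonzero determinant gives some inverse \<open>W\<close>; finiteness of the field then
  places an inverse inside the unitriangular set.\<close>

lemma unitriangular_inverse:
  fixes U :: "'a::{field,finite} mat"
  assumes U: "U \<in> unitriangular_mats n"
  obtains V where "V \<in> unitriangular_mats n" "U * V = 1\<^sub>m n" "V * U = 1\<^sub>m n"
proof -
  have Uc: "U \<in> carrier_mat n n" and ut: "upper_triangular U"
    and one: "\<And>i. i < n \<Longrightarrow> U $$ (i, i) = 1"
    using U by (auto simp: unitriangular_iff upper_triangular_mats_def)
  have "det U \<noteq> 0"
    using Uc one ut upper_triangular_imp_det_eq_0_iff[OF Uc ut] by (auto simp: diag_mat_def)
  then obtain W where W: "W \<in> carrier_mat n n" "W * U = 1\<^sub>m n" "U * W = 1\<^sub>m n"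
    using det_non_zero_imp_unit[OF Uc] unfolding Units_def ring_mat_def by auto
  \<comment> \<open>Left multiplication by \<open>U\<close> is an injective self-map of a finite
    set, hence onto, so it hits the identity. \<open>W\<close> serves only for cancellation.\<close>
  have "inj_on ((*) U) (unitriangular_mats n)"
  proof (rule inj_onI)
    fix V V'
    assume "V \<in> unitriangular_mats n" "V' \<in> unitriangular_mats n" and eq: "U * V = U * V'"
    then have V: "V \<in> carrier_mat n n" "V' \<in> carrier_mat n n"
      by (auto simp: unit_mats_def)
    have "W * U * V = W * U * V'"
      using assoc_mult_mat[OF W(1) Uc V(1)] assoc_mult_mat[OF W(1) Uc V(2)] eq by simp
    then show "V = V'"
      using W V by simp
  qed
  moreover have "(*) U ` unitriangular_mats n \<subseteq> unitriangular_mats n"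
    using unitriangular_mult[OF U] by auto
  ultimately have "(*) U ` unitriangular_mats n = unitriangular_mats n"
    by (intro endo_inj_surj finite_unit_mats upper_pairs_subset)
  moreover have "1\<^sub>m n \<in> unitriangular_mats n"
    by (auto simp: unit_mats_def)
  ultimately obtain V where V: "V \<in> unitriangular_mats n" "U * V = 1\<^sub>m n"
    by (metis imageE)
  moreover have "V * U = 1\<^sub>m n"
    using mat_mult_left_right_inverse[OF Uc _ V(2)] V(1) by (auto simp: unit_mats_def)
  ultimately show ?thesis
    by (rule that)
qed

section \<open>Potent matrices with a prescribed diagonal\<close>

definition potent_mats :: "nat \<Rightarrow> nat \<Rightarrow> (nat \<Rightarrow> 'a) \<Rightarrow> 'a::semiring_1 mat set" where
  "potent_mats k n d =
     {A \<in> upper_triangular_mats n. potent_mat (k + 1) A \<and> (\<forall>i<n. A $$ (i, i) = d i)}"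

lemma mat_diag_pow: "mat_diag n d ^\<^sub>m m = mat_diag n (\<lambda>i. d i ^ m)"
proof (induction m)
  case 0
  then show ?case
    by (simp add: mat_diag_def one_mat_def)
next
  case (Suc m)
  then show ?case
    by (simp add: power_commutes)
qed

text \<open>The first summand of \<open>U\<close> is annihilated by A on the left and by \<Delta> on
  the right. In the second, a factor A on the left or \<Delta> on the right gives the same terms up
  to a cyclic shift of \<open>m\<close>. The exponent 2k - m is at least k > 0, so the eigenvalue 0
  contributes only through the first summand.\<close>

lemma potent_conjugate_diag:
  fixes A :: "'a::field mat"
  assumes k: "of_nat k \<noteq> (0::'a)" and A: "A \<in> potent_mats k n d"
  obtains U where "U \<in> unitriangular_mats n" "A * U = U * mat_diag n d"
proof -
  have Aut: "A \<in> upper_triangular_mats n" and Ac: "A \<in> carrier_mat n n"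
    and Ap: "A ^\<^sub>m Suc k = A" and Ad: "\<And>i. i < n \<Longrightarrow> A $$ (i, i) = d i"
    using A by (auto simp: potent_mats_def upper_triangular_mats_def potent_mat_def)
  have dp: "d i ^ Suc k = d i" if "i < n" for i
    using upper_triangular_pow(2)[OF Aut that, of "Suc k"] Ap Ad[OF that] by simp
  have pow0: "(A ^\<^sub>m m) $$ (i, j) = 0" if "j < i" "i < n" for m i j
    using upper_triangular_pow(1)[OF Aut, of m] that by (auto simp: upper_triangular_mats_def)
  have powd: "(A ^\<^sub>m m) $$ (i, i) = d i ^ m" if "i < n" for m i
    using upper_triangular_pow(2)[OF Aut that] Ad[OF that] by simp
  \<comment> \<open>$U = \sum_\lambda P_\lambda(A) P_\lambda(\Delta)$, where $P_\lambda$ is the spectral idempotent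
     of an eigenvalue $\lambda$; summing over the roots of $x^{k+1} - x$ eliminates $\lambda$.\<close>
  define u where "u i j = (1\<^sub>m n - A ^\<^sub>m k) $$ (i, j) * (1 - d j ^ k)
    + (\<Sum>m = 1..k. (A ^\<^sub>m m) $$ (i, j) * d j ^ (2 * k - m)) / of_nat k" for i j
  define U where "U = mat n n (\<lambda>(i, j). u i j)"
  have Pc: "A ^\<^sub>m m \<in> carrier_mat n n" for m
    using Ac by simp
  have "u i j = 0" if "j < i" "i < n" for i j
    using that Ac by (simp add: u_def pow0)
  moreover have "u i i = 1" if "i < n" for i
  proof -
    \<comment> \<open>On the diagonal all k terms coincide, cancelling 1/k. With e =
      \<open>d i ^ k\<close> in {0, 1} the entry is (1 - e)^2 + e^2 = 1.\<close>
    have "(\<Sum>m = 1..k. (A ^\<^sub>m m) $$ (i, i) * d i ^ (2 * k - m)) = (\<Sum>m = 1..k. d i ^ (2 * k))"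
      using that by (intro sum.cong) (auto simp: powd simp flip: power_add)
    moreover have "d i ^ (2 * k) = d i ^ k * d i ^ k"
      by (simp add: mult_2 power_add)
    moreover have "d i ^ k = 0 \<or> d i ^ k = 1"
      using dp[OF that] k by (cases "d i = 0") (auto intro: gr0I)
    ultimately show ?thesis
      using that Ac k by (auto simp: u_def powd power_0_left)
  qed
  ultimately have "U \<in> unitriangular_mats n"
    by (auto simp: unit_mats_def upper_pairs_def U_def)
  moreover have "A * U = U * mat_diag n d"
  proof (rule eq_matI)
    fix i j
    assume "i < dim_row (U * mat_diag n d)" "j < dim_col (U * mat_diag n d)"
    then have ij: "i < n" "j < n"
      by (auto simp: U_def mat_diag_def)
    \<comment> \<open>\<open>A ^\<^sub>m Suc m\<close> unfolds with the new factor on the right, so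
      multiplying from the left requires that A commutes with its powers.\<close>
    have prod: "(\<Sum>l = 0..<n. A $$ (i, l) * (A ^\<^sub>m m) $$ (l, j)) = (A ^\<^sub>m Suc m) $$ (i, j)" for m
    proof -
      have "A * A ^\<^sub>m m = A ^\<^sub>m Suc m"
      proof (induction m)
        case 0
        show ?case using Ac by simp
      next
        case (Suc m)
        have "A * (A ^\<^sub>m m * A) = A * A ^\<^sub>m m * A"
          using assoc_mult_mat[OF Ac Pc Ac] by simp
        then show ?case
          using Suc by simp
      qed
      moreover have "(A * A ^\<^sub>m m) $$ (i, j) = (\<Sum>l = 0..<n. A $$ (i, l) * (A ^\<^sub>m m) $$ (l, j))"
        using ij Ac by (simp add: scalar_prod_def)
      ultimately show ?thesis by simp
    qed
    have prod1: "(\<Sum>l = 0..<n. A $$ (i, l) * (1\<^sub>m n - A ^\<^sub>m k) $$ (l, j)) = 0"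
    proof -
      have "(\<Sum>l = 0..<n. A $$ (i, l) * (1\<^sub>m n - A ^\<^sub>m k) $$ (l, j)) =
        (\<Sum>l = 0..<n. A $$ (i, l) * (1\<^sub>m n) $$ (l, j)) - (A ^\<^sub>m Suc k) $$ (i, j)"
        using ij Ac unfolding prod[symmetric] sum_subtractf[symmetric]
        by (intro sum.cong) (auto simp: right_diff_distrib)
      also have "(\<Sum>l = 0..<n. A $$ (i, l) * (1\<^sub>m n) $$ (l, j)) = A $$ (i, j)"
        using prod[of 0] Ac ij by simp
      finally show ?thesis
        using Ap by simp
    qed
    have "(A * U) $$ (i, j) = (\<Sum>l = 0..<n. A $$ (i, l) * u l j)"
      using ij Ac by (simp add: scalar_prod_def U_def)
    also have "\<dots> = (\<Sum>l = 0..<n. A $$ (i, l) * (1\<^sub>m n - A ^\<^sub>m k) $$ (l, j)) * (1 - d j ^ k)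
      + (\<Sum>l = 0..<n. A $$ (i, l) *
           (\<Sum>m = 1..k. (A ^\<^sub>m m) $$ (l, j) * d j ^ (2 * k - m))) / of_nat k"
      unfolding u_def sum_divide_distrib[of _ "{0..<n}"] sum_distrib_right
      by (simp add: distrib_left sum.distrib mult.assoc)
    also have "(\<Sum>l = 0..<n. A $$ (i, l) *
           (\<Sum>m = 1..k. (A ^\<^sub>m m) $$ (l, j) * d j ^ (2 * k - m)))
       = (\<Sum>m = 1..k. (\<Sum>l = 0..<n. A $$ (i, l) * (A ^\<^sub>m m) $$ (l, j)) * d j ^ (2 * k - m))"
      unfolding sum_distrib_left sum_distrib_right
      by (subst sum.swap) (simp add: mult.assoc)
    also have "\<dots> = (\<Sum>m = 1..k. (A ^\<^sub>m Suc m) $$ (i, j) * d j ^ (2 * k - m))"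
      by (simp only: prod)
    also have "\<dots> = (\<Sum>m = 1..k. (A ^\<^sub>m m) $$ (i, j) * d j ^ (2 * k - m)) * d j"
    proof -
      \<comment> \<open>\<open>f (Suc m)\<close> is a term of the left sum and \<open>f m\<close>
        one of the right sum, so the sums differ only by \<open>f (Suc k)\<close> against
        \<open>f 1\<close>. These agree because A^(k+1) = A and d^(2k) = d^(k+1) d^(k-1) =
        d^k.\<close>
      define f where "f m = (A ^\<^sub>m m) $$ (i, j) * d j ^ (2 * k + 1 - m)" for m
      have "k \<noteq> 0"
        using k by (intro notI) simp
      then have "2 * k = Suc k + (k - 1)" "k = Suc (k - 1)"
        by simp_all
      then have dk: "d j ^ (2 * k) = d j ^ k"
        using dp[OF ij(2)] by (metis power_Suc power_add)
      have "f (Suc k) = f 1"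
        using Ap dk Ac by (simp add: f_def)
      then have "(\<Sum>m = 1..k. f (Suc m)) = (\<Sum>m = 1..k. f m)"
        using sum.atLeast_Suc_atMost_Suc_shift[of f 1 k] \<open>k \<noteq> 0\<close>
          sum.atLeast_Suc_atMost[of 1 "Suc k" f] sum.cl_ivl_Suc[of f 1 k]
        by (simp add: add.commute)
      moreover have "f (Suc m) = (A ^\<^sub>m Suc m) $$ (i, j) * d j ^ (2 * k - m)" for m
        by (simp add: f_def)
      moreover have "f m = (A ^\<^sub>m m) $$ (i, j) * d j ^ (2 * k - m) * d j" if "m \<le> k" for m
      proof -
        have "2 * k + 1 - m = Suc (2 * k - m)" using that by simp
        then show ?thesis by (simp add: f_def)
      qed
      ultimately show ?thesis
        by (simp add: sum_distrib_right)
    qed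
    finally have AU: "(A * U) $$ (i, j) =
        (\<Sum>m = 1..k. (A ^\<^sub>m m) $$ (i, j) * d j ^ (2 * k - m)) * d j / of_nat k"
      unfolding prod1 by simp
    have "(1 - d j ^ k) * d j = 0"
      using dp[OF ij(2)] by (simp add: algebra_simps)
    then have "u i j * d j =
        (\<Sum>m = 1..k. (A ^\<^sub>m m) $$ (i, j) * d j ^ (2 * k - m)) * d j / of_nat k"
      by (simp add: u_def distrib_right mult.assoc)
    moreover have "(U * mat_diag n d) $$ (i, j) = u i j * d j"
      using ij by (subst mat_diag_mult_right[of _ n]) (auto simp: U_def)
    ultimately show "(A * U) $$ (i, j) = (U * mat_diag n d) $$ (i, j)"
      using AU by simp
  qed (use Ac in \<open>auto simp: U_def mat_diag_def\<close>)
  ultimately show ?thesis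
    by (rule that)
qed

text \<open>This is the converse direction: potency passes along similarity, and the unit diagonals
  of \<open>U\<close> and \<open>V\<close> leave the diagonal unchanged.\<close>

lemma conjugate_diag_potent:
  fixes U V :: "'a::field mat"
  assumes U: "U \<in> unitriangular_mats n" and V: "V \<in> unitriangular_mats n"
    and UV: "U * V = 1\<^sub>m n" and VU: "V * U = 1\<^sub>m n"
    and d: "\<And>i. i < n \<Longrightarrow> d i ^ (k + 1) = d i"
  shows "U * mat_diag n d * V \<in> potent_mats k n d"
proof -
  let ?D = "mat_diag n d" and ?A = "U * mat_diag n d * V"
  have c: "U \<in> carrier_mat n n" "V \<in> carrier_mat n n"
    using U V by (auto simp: unit_mats_def)
  have D: "?D \<in> upper_triangular_mats n"
    by (auto simp: upper_triangular_mats_def mat_diag_def)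
  have "U \<in> upper_triangular_mats n" "V \<in> upper_triangular_mats n"
    using U V by (auto simp: unitriangular_iff)
  note UD = upper_triangular_mult[OF this(1) D]
    and UDV = upper_triangular_mult[OF upper_triangular_mult(1)[OF this(1) D] this(2)]
  have "?A $$ (i, i) = d i" if "i < n" for i
    unfolding UDV(2)[OF that] UD(2)[OF that] using U V that
    by (simp add: unitriangular_iff mat_diag_def)
  moreover have "similar_mat_wit ?A ?D U V"
    using c UV VU by (intro similar_mat_witI[of _ _ n]) auto
  then have "?A ^\<^sub>m (k + 1) = U * ?D ^\<^sub>m (k + 1) * V"
    by (rule similar_mat_wit_pow_id)
  moreover have "?D ^\<^sub>m (k + 1) = ?D"
    unfolding mat_diag_pow using d by (auto simp: mat_diag_def)
  ultimately show ?thesis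
    using UDV(1) by (simp add: potent_mats_def potent_mat_def)
qed

text \<open>Orbit counting by fibres: the sets \<open>F A\<close> of matrices conjugating \<Delta>
  to A partition the unitriangular group, and each is a coset of the centralizer
  \<open>F ?D\<close>. Dividing the group order by the common fibre size gives the count.\<close>

lemma card_potent_mats:
  fixes d :: "nat \<Rightarrow> 'a::{field,finite}"
  assumes k: "of_nat k \<noteq> (0::'a)" and d: "\<And>i. i < n \<Longrightarrow> d i ^ (k + 1) = d i"
  shows "card (potent_mats k n d) =
    card (UNIV :: 'a set) ^ card {(i, j). i < j \<and> j < n \<and> d i \<noteq> d j}"
proof -
  let ?q = "card (UNIV :: 'a set)" and ?D = "mat_diag n d"
  define E where "E = {(i, j). i < j \<and> j < n \<and> d i = d j}"
  define F where "F A = {U \<in> unitriangular_mats n. A * U = U * ?D}" for A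
  have Dc: "?D \<in> carrier_mat n n" by simp
  have E: "E \<subseteq> {..<n} \<times> {..<n}"
    by (auto simp: E_def)
  have centralizer: "F ?D = unit_mats n E"
  proof -
    \<comment> \<open>The (i, j) entries of the two products are \<open>d i * U $$ (i, j)\<close>
      and \<open>U $$ (i, j) * d j\<close>, so exactly the positions with equal diagonal values stay
      free.\<close>
    have "?D * U = U * ?D \<longleftrightarrow> (\<forall>i<n. \<forall>j<n. d i = d j \<or> U $$ (i, j) = 0)"
      if "U \<in> carrier_mat n n" for U
      unfolding mat_diag_mult_left[OF that] mat_diag_mult_right[OF that] mat_eq_iff
      by (auto simp: mult.commute)
    then show ?thesis
      by (auto simp: F_def unit_mats_def upper_pairs_def E_def)
  qed
  have cardF: "card (F A) = ?q ^ card E" if A: "A \<in> potent_mats k n d" for A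
  proof -
    have Ac: "A \<in> carrier_mat n n"
      using A by (auto simp: potent_mats_def upper_triangular_mats_def)
    obtain U where U: "U \<in> unitriangular_mats n" "A * U = U * ?D"
      using potent_conjugate_diag[OF k A] .
    obtain V where V: "V \<in> unitriangular_mats n" "U * V = 1\<^sub>m n" "V * U = 1\<^sub>m n"
      using unitriangular_inverse[OF U(1)] .
    have Uc: "U \<in> carrier_mat n n" and Vc: "V \<in> carrier_mat n n"
      using U V by (auto simp: unit_mats_def)
    have VA: "V * A = ?D * V"
    proof -
      have "V * A = V * (A * U) * V"
        using Ac Uc Vc V by (simp add: assoc_mult_mat[of _ n n _ n _ n])
      also have "\<dots> = V * U * ?D * V"
        unfolding U(2) using Ac Uc Vc by (simp add: assoc_mult_mat[of _ n n _ n _ n])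
      finally show ?thesis
        unfolding V using left_mult_one_mat[OF Dc] by simp
    qed
    \<comment> \<open>One intertwiner \<open>U\<close> of A yields all others: \<open>F A\<close> is
      the left coset of \<open>F ?D\<close> by \<open>U\<close>, with inverse map given by
      \<open>V\<close>.\<close>
    have "bij_betw ((*) U) (F ?D) (F A)"
    proof (rule bij_betw_byWitness[where f' = "(*) V"])
      have "V * (U * W) = W" "U * (V * W) = W" if "W \<in> unitriangular_mats n" for W
      proof -
        have W: "W \<in> carrier_mat n n" using that by (auto simp: unit_mats_def)
        show "V * (U * W) = W" "U * (V * W) = W"
          using W V assoc_mult_mat[OF Uc Vc W] assoc_mult_mat[OF Vc Uc W] by auto
      qed
      then show "\<forall>W\<in>F ?D. V * (U * W) = W" "\<forall>W\<in>F A. U * (V * W) = W"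
        by (auto simp: F_def)
      show "(*) U ` F ?D \<subseteq> F A"
      proof (clarsimp simp: F_def unitriangular_mult[OF U(1)])
        fix W :: "'a mat"
        assume "W \<in> unitriangular_mats n" and WD: "?D * W = W * ?D"
        then have W: "W \<in> carrier_mat n n" by (auto simp: unit_mats_def)
        have "A * (U * W) = U * (?D * W)"
          using assoc_mult_mat[OF Ac Uc W] assoc_mult_mat[OF Uc Dc W] U(2) by simp
        then show "A * (U * W) = U * W * ?D"
          using assoc_mult_mat[OF Uc W Dc] WD by simp
      qed
      show "(*) V ` F A \<subseteq> F ?D"
      proof (clarsimp simp: F_def unitriangular_mult[OF V(1)])
        fix W :: "'a mat"
        assume "W \<in> unitriangular_mats n" and WD: "A * W = W * ?D"
        then have W: "W \<in> carrier_mat n n" by (auto simp: unit_mats_def)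
        have "?D * (V * W) = V * (A * W)"
          using assoc_mult_mat[OF Dc Vc W] assoc_mult_mat[OF Vc Ac W] VA by simp
        then show "?D * (V * W) = V * W * ?D"
          using assoc_mult_mat[OF Vc W Dc] WD by simp
      qed
    qed
    then have "card (F A) = card (F ?D)"
      by (simp add: bij_betw_same_card)
    then show ?thesis
      unfolding centralizer using card_unit_mats[OF E] by simp
  qed
  \<comment> \<open>Each unitriangular \<open>U\<close> lies in the fibre of its own conjugate of
    \<Delta>.\<close>
  have union: "(\<Union>A\<in>potent_mats k n d. F A) = unitriangular_mats n"
  proof
    show "unitriangular_mats n \<subseteq> (\<Union>A\<in>potent_mats k n d. F A)"
    proof
      fix U :: "'a mat"
      assume U: "U \<in> unitriangular_mats n"
      obtain V where V: "V \<in> unitriangular_mats n" "U * V = 1\<^sub>m n" "V * U = 1\<^sub>m n"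
        using unitriangular_inverse[OF U] .
      have Uc: "U \<in> carrier_mat n n" and Vc: "V \<in> carrier_mat n n"
        using U V by (auto simp: unit_mats_def)
      have "U * ?D * V \<in> potent_mats k n d"
        using U V d by (rule conjugate_diag_potent)
      moreover have "U * ?D * V * U = U * ?D"
        using assoc_mult_mat[of "U * ?D" n n V n U n] Uc Vc V(3)
          right_mult_one_mat[of "U * ?D" n n] by simp
      ultimately show "U \<in> (\<Union>A\<in>potent_mats k n d. F A)"
        using U by (auto simp: F_def)
    qed
  qed (auto simp: F_def)
  \<comment> \<open>Since \<open>U\<close> is invertible, the product \<open>A * U\<close>
    determines A.\<close>
  have disj: "F A \<inter> F B = {}"
    if "A \<in> potent_mats k n d" "B \<in> potent_mats k n d" "A \<noteq> B" for A B
  proof (rule ccontr)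
    assume "F A \<inter> F B \<noteq> {}"
    then obtain U where "U \<in> F A" "U \<in> F B"
      by blast
    then have U: "U \<in> unitriangular_mats n" and eq: "A * U = B * U"
      by (auto simp: F_def)
    obtain V where V: "V \<in> unitriangular_mats n" "U * V = 1\<^sub>m n"
      using unitriangular_inverse[OF U] by metis
    have "U \<in> carrier_mat n n" "V \<in> carrier_mat n n" "A \<in> carrier_mat n n" "B \<in> carrier_mat n n"
      using U V that by (auto simp: unit_mats_def potent_mats_def upper_triangular_mats_def)
    then have "A = A * U * V" "B = B * U * V"
      using V(2) by (simp_all add: assoc_mult_mat[of _ n n _ n _ n])
    then show False
      using eq \<open>A \<noteq> B\<close> by simp
  qed
  have finF: "finite (F A)" for A
    using finite_unit_mats[OF upper_pairs_subset] by (rule finite_subset[rotated]) (auto simp: F_def)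
  have q: "?q > 0"
    by (simp add: card_gt_0_iff)
  have fin: "finite (potent_mats k n d)"
  proof (rule finite_subset)
    show "potent_mats k n d \<subseteq> unit_mats n ({..<n} \<times> {..<n})"
      by (auto simp: potent_mats_def upper_triangular_mats_def unit_mats_def)
  qed (simp add: finite_unit_mats)
  have "?q ^ card (upper_pairs n) = card (\<Union>A\<in>potent_mats k n d. F A)"
    unfolding union by (rule card_unit_mats[OF upper_pairs_subset, symmetric])
  also have "\<dots> = (\<Sum>A\<in>potent_mats k n d. card (F A))"
    using fin finF disj by (intro card_UN_disjoint) auto
  also have "\<dots> = card (potent_mats k n d) * ?q ^ card E"
    using cardF by simp
  finally have count: "?q ^ card (upper_pairs n) = card (potent_mats k n d) * ?q ^ card E" .
  \<comment> \<open>Splitting the pairs by equality of the diagonal values turns the quotient of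
    powers of q into a single power; q > 0 permits the cancellation.\<close>
  have "upper_pairs n = E \<union> {(i, j). i < j \<and> j < n \<and> d i \<noteq> d j}"
    by (auto simp: upper_pairs_def E_def)
  moreover have "finite E"
    using E by (rule finite_subset) simp
  moreover have "finite {(i, j). i < j \<and> j < n \<and> d i \<noteq> d j}"
    by (rule finite_subset[OF _ finite_upper_pairs[of n]]) (auto simp: upper_pairs_def)
  ultimately have "card (upper_pairs n) = card E + card {(i, j). i < j \<and> j < n \<and> d i \<noteq> d j}"
    by (subst card_Un_disjoint[symmetric]) (auto simp: E_def)
  then show ?thesis
    using count q by (simp add: power_add)
qed

section \<open>Words with given multiplicities, and their pairs of distinct letters\<close>

text \<open>Such words are the arrangements of a multiset in which the letter \<open>i\<close> has
  multiplicity \<open>ns ! i\<close>.\<close>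

lemma card_lists_with_counts:
  "card {xs. set xs \<subseteq> {..<length ns} \<and> (\<forall>i<length ns. count_list xs i = ns ! i)} = multinomial ns"
proof -
  define M where "M = (\<Sum>i<length ns. replicate_mset (ns ! i) i)"
  have cnt: "count M i = (if i < length ns then ns ! i else 0)" for i
    by (simp add: M_def count_sum)
  have "size (\<Sum>i<m. replicate_mset (ns ! i) i) = (\<Sum>i<m. ns ! i)" for m
    by (induction m) auto
  then have size: "size M = sum_list ns"
    by (simp add: M_def sum_list_sum_nth atLeast0LessThan)
  have "{xs. set xs \<subseteq> {..<length ns} \<and> (\<forall>i<length ns. count_list xs i = ns ! i)} =
      permutations_of_multiset M"
  proof (rule Set.set_eqI)
    fix xs
    have "mset xs = M \<longleftrightarrow> (\<forall>i. count_list xs i = (if i < length ns then ns ! i else 0))"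
      by (simp add: multiset_eq_iff cnt count_mset)
    also have "\<dots> \<longleftrightarrow> set xs \<subseteq> {..<length ns} \<and> (\<forall>i<length ns. count_list xs i = ns ! i)"
      by (auto simp: subset_iff count_list_0_iff)
    finally show "xs \<in> {xs. set xs \<subseteq> {..<length ns} \<and> (\<forall>i<length ns. count_list xs i = ns ! i)}
        \<longleftrightarrow> xs \<in> permutations_of_multiset M"
      by (simp add: permutations_of_multiset_def)
  qed
  moreover have "(\<Prod>x\<in>set_mset M. fact (count M x) :: nat) = (\<Prod>i<length ns. fact (ns ! i))"
  proof -
    \<comment> \<open>Letters of multiplicity 0 are missing from \<open>set_mset M\<close>, but each
      would contribute only \<open>fact 0 = 1\<close>.\<close>
    have "(\<Prod>x\<in>set_mset M. fact (count M x) :: nat) = (\<Prod>i<length ns. fact (count M i))"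
      by (rule prod.mono_neutral_left) (auto simp: not_in_iff cnt simp flip: count_greater_zero_iff split: if_splits)
    then show ?thesis
      by (simp add: cnt)
  qed
  ultimately show ?thesis
    by (simp add: card_permutations_of_multiset size multinomial_def)
qed

text \<open>Ordering each pair of positions by letter instead of by position turns the set into a
  disjoint union of rectangles \<open>I a \<times> I b\<close> with a < b.\<close>

lemma card_index_pairs_distinct:
  fixes xs :: "nat list"
  assumes "set xs \<subseteq> {..k}"
  shows "card {(i, j). i < j \<and> j < length xs \<and> xs ! i \<noteq> xs ! j} =
    (\<Sum>(a, b)\<in>{(a, b). a < b \<and> b \<le> k}. count_list xs a * count_list xs b)"
proof -
  let ?n = "length xs"
  define S where "S = {(i, j). i < j \<and> j < ?n \<and> xs ! i \<noteq> xs ! j}"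
  define T where "T = {(i, j). i < ?n \<and> j < ?n \<and> xs ! i < xs ! j}"
  define I where "I a = {i. i < ?n \<and> xs ! i = a}" for a
  have cardI: "card (I a) = count_list xs a" for a
    by (simp add: I_def count_list_eq_length_filter length_filter_conv_card eq_commute)
  have "bij_betw (\<lambda>(i, j). if xs ! i < xs ! j then (i, j) else (j, i)) S T"
    by (rule bij_betw_byWitness[where f' = "\<lambda>(i, j). if i < j then (i, j) else (j, i)"])
      (auto simp: S_def T_def linorder_neq_iff split: if_splits, metis linorder_neqE_nat less_irrefl)
  then have "card S = card T"
    by (rule bij_betw_same_card)
  also have "T = (\<Union>(a, b)\<in>{(a, b). a < b \<and> b \<le> k}. I a \<times> I b)"
    using assms by (fastforce simp: T_def I_def subset_iff in_set_conv_nth)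
  also have "card \<dots> = (\<Sum>(a, b)\<in>{(a, b). a < b \<and> b \<le> k}. card (I a \<times> I b))"
  proof -
    have "finite {(a, b). a < b \<and> b \<le> k}"
      by (rule finite_subset[of _ "{..k} \<times> {..k}"]) auto
    then show ?thesis
      by (subst card_UN_disjoint) (auto simp: I_def split_def)
  qed
  finally show ?thesis
    by (simp add: S_def card_cartesian_product cardI)
qed

section \<open>Enumeration of the diagonal values\<close>

text \<open>This indexes D by 0, ..., k, with the value 0 at index 0 and the powers of w shifted by
  one, so that diagonals become words over \<open>{..k}\<close>.\<close>

definition diag_value :: "'a::semiring_1 \<Rightarrow> nat \<Rightarrow> 'a" where
  "diag_value w i = (if i = 0 then 0 else w ^ (i - 1))"

lemma diag_value_image: "diag_value w ` {..k} = diag_values k w"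
proof -
  have "diag_value w ` Suc ` {..<k} = (\<lambda>i. w ^ i) ` {..<k}"
    unfolding image_image by (rule image_cong) (auto simp: diag_value_def)
  also have "\<dots> = {w ^ i |i. i < k}"
    by auto
  finally have "diag_value w ` Suc ` {..<k} = {w ^ i |i. i < k}" .
  moreover have "{..k} = insert 0 (Suc ` {..<k})"
    by (simp add: atMost_Suc_eq_insert_0 lessThan_Suc_atMost[symmetric] lessThan_Suc_eq_insert_0)
  ultimately show ?thesis
    by (simp add: diag_values_def diag_value_def)
qed

text \<open>A coincidence of indices 0 < i < j \<le> k would force w^(j-i) = 1 with 0 < j - i < k,
  against primitivity; index 0 is separate because w is a unit.\<close>

lemma inj_on_diag_value:
  fixes w :: "'a::field"
  assumes "primitive_root_of_unity k w"
  shows "inj_on (diag_value w) {..k}"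
proof -
  have wk: "w ^ k = 1" and prim: "\<And>j. 0 < j \<Longrightarrow> j < k \<Longrightarrow> w ^ j \<noteq> 1"
    using assms by (auto simp: primitive_root_of_unity_def root_of_unity_def)
  have w0: "w \<noteq> 0" if "0 < k"
    using wk that by (auto simp: power_0_left)
  have "diag_value w i \<noteq> diag_value w j" if "i < j" "j \<le> k" for i j
  proof (cases "i = 0")
    case True
    then show ?thesis
      using that w0 by (simp add: diag_value_def)
  next
    case False
    have "w ^ (j - 1) = w ^ (i - 1) * w ^ (j - i)"
      using that False by (simp flip: power_add)
    then show ?thesis
      using that False w0 prim[of "j - i"] by (auto simp: diag_value_def)
  qed
  then show ?thesis
    by (intro inj_onI) (metis atMost_iff linorder_neqE_nat)
qed

lemma diag_value_potent:
  fixes w :: "'a::field"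
  assumes "w ^ k = 1"
  shows "diag_value w i ^ (k + 1) = diag_value w i"
  using assms by (simp add: diag_value_def power_add flip: power_mult) (simp add: power_mult mult.commute)

section \<open>Summation over all diagonals\<close>

theorem theorem1p2:
  fixes k n q :: nat
    and \<omega> :: "'a::{field,finite}"
  assumes "k \<ge> 1"
    and "\<not> CHAR('a) dvd k"
    and "\<not> CHAR('a) dvd k + 1"
    and "card (UNIV :: 'a set) = q"
    and "primitive_root_of_unity k \<omega>"
  shows "card {A \<in> (upper_triangular_mats n :: 'a mat set).
                 potent_mat (k + 1) A \<and> (\<forall>i<n. A $$ (i, i) \<in> diag_values k \<omega>)}
       = (\<Sum>ns \<in> weak_compositions (k + 1) n.
            multinomial ns * q ^ (\<Sum>(i, j) \<in> {(i, j). i < j \<and> j \<le> k}. ns ! i * ns ! j))"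
proof -
  let ?e = "diag_value \<omega>"
  \<comment> \<open>A word \<open>xs\<close> in \<open>L\<close> encodes a diagonal,
    \<open>P xs\<close> collects the matrices with that diagonal, and \<open>c xs\<close> is its
    multiplicity vector.\<close>
  let ?w = "\<lambda>ns. \<Sum>(i, j) \<in> {(i, j). i < j \<and> j \<le> k}. ns ! i * ns ! j"
  define L where "L = {xs. set xs \<subseteq> {..k} \<and> length xs = n}"
  define P where "P xs = potent_mats k n (\<lambda>i. ?e (xs ! i))" for xs
  define c where "c xs = map (count_list xs) [0..<k + 1]" for xs
  have finL: "finite L"
    unfolding L_def by (rule finite_lists_length_eq) simp
  have kne: "of_nat k \<noteq> (0 :: 'a)"
    using assms(2) by (simp add: of_nat_eq_0_iff_char_dvd)
  have wk: "\<omega> ^ k = 1"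
    using assms(5) by (simp add: primitive_root_of_unity_def root_of_unity_def)
  note inj = inj_on_diag_value[OF assms(5)]
  have c_nth: "c xs ! i = count_list xs i" if "i \<le> k" for xs i
    using that by (simp add: c_def del: upt_Suc)
  have cardP: "card (P xs) = q ^ ?w (c xs)" if "xs \<in> L" for xs
  proof -
    have xs: "set xs \<subseteq> {..k}" "length xs = n"
      using that by (auto simp: L_def)
    \<comment> \<open>Injectivity of the enumeration replaces comparison of field elements by
      comparison of letters.\<close>
    have "{(i, j). i < j \<and> j < n \<and> ?e (xs ! i) \<noteq> ?e (xs ! j)} =
        {(i, j). i < j \<and> j < length xs \<and> xs ! i \<noteq> xs ! j}"
    proof -
      have "xs ! i \<in> {..k}" if "i < n" for i
        using xs that nth_mem by blast
      then show ?thesis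
        using xs(2) inj_on_eq_iff[OF inj] by auto
    qed
    moreover have "?w (c xs) = (\<Sum>(a, b)\<in>{(a, b). a < b \<and> b \<le> k}. count_list xs a * count_list xs b)"
      by (rule sum.cong) (auto simp: c_nth)
    ultimately show ?thesis
      using card_potent_mats[OF kne diag_value_potent[OF wk]] card_index_pairs_distinct[OF xs(1)]
      by (simp add: P_def assms(4))
  qed
  have union: "{A \<in> (upper_triangular_mats n :: 'a mat set).
      potent_mat (k + 1) A \<and> (\<forall>i<n. A $$ (i, i) \<in> diag_values k \<omega>)} = (\<Union>xs\<in>L. P xs)"
  proof (intro equalityI subsetI)
    fix A :: "'a mat"
    assume A: "A \<in> {A \<in> upper_triangular_mats n.
      potent_mat (k + 1) A \<and> (\<forall>i<n. A $$ (i, i) \<in> diag_values k \<omega>)}"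
    then have "\<forall>i<n. \<exists>a. a \<le> k \<and> A $$ (i, i) = ?e a"
      unfolding diag_value_image[symmetric] by auto
    then obtain f where f: "\<And>i. i < n \<Longrightarrow> f i \<le> k \<and> A $$ (i, i) = ?e (f i)"
      by metis
    then have "map f [0..<n] \<in> L" "A \<in> P (map f [0..<n])"
      using A by (auto simp: L_def P_def potent_mats_def)
    then show "A \<in> (\<Union>xs\<in>L. P xs)"
      by blast
  next
    fix A :: "'a mat"
    assume "A \<in> (\<Union>xs\<in>L. P xs)"
    then obtain xs where "xs \<in> L" "A \<in> P xs" by blast
    moreover have "?e (xs ! i) \<in> diag_values k \<omega>" if "xs \<in> L" "i < n" for i
      using that nth_mem[of i xs] unfolding diag_value_image[symmetric] L_def by blast
    ultimately show "A \<in> {A \<in> upper_triangular_mats n.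
      potent_mat (k + 1) A \<and> (\<forall>i<n. A $$ (i, i) \<in> diag_values k \<omega>)}"
      by (auto simp: P_def potent_mats_def)
  qed
  have disj: "P xs \<inter> P ys = {}" if "xs \<in> L" "ys \<in> L" "xs \<noteq> ys" for xs ys
  proof (rule ccontr)
    assume "P xs \<inter> P ys \<noteq> {}"
    then have e: "?e (xs ! i) = ?e (ys ! i)" if "i < n" for i
      using that by (auto simp: P_def potent_mats_def)
    have "xs ! i = ys ! i" if "i < n" for i
    proof -
      have "xs ! i \<in> set xs" "ys ! i \<in> set ys"
        using \<open>xs \<in> L\<close> \<open>ys \<in> L\<close> that by (auto simp: L_def)
      then have "xs ! i \<in> {..k}" "ys ! i \<in> {..k}"
        using \<open>xs \<in> L\<close> \<open>ys \<in> L\<close> unfolding L_def by blast+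
      then show ?thesis
        using e[OF that] by (rule inj_onD[OF inj, rotated 1])
    qed
    then show False
      using that by (auto simp: L_def intro: nth_equalityI)
  qed
  \<comment> \<open>\<open>card\<close> is 0 on infinite sets, so the positive power of q already
    certifies finiteness.\<close>
  have finP: "finite (P xs)" if "xs \<in> L" for xs
  proof (rule card_ge_0_finite)
    show "card (P xs) > 0"
      unfolding cardP[OF that] using assms(4) by (auto simp: card_gt_0_iff)
  qed
  have count_sum: "(\<Sum>i\<le>k. count_list xs i) = length xs" if "set xs \<subseteq> {..k}" for xs :: "nat list"
  proof -
    have "(\<Sum>i\<le>k. count_list xs i) = (\<Sum>i\<in>set xs. count_list xs i)"
      using that by (intro sum.mono_neutral_right) (auto simp: count_list_0_iff)
    then show ?thesis
      by (simp add: sum_count_set)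
  qed
  have c_L: "c ` L \<subseteq> weak_compositions (k + 1) n"
  proof (clarsimp simp: weak_compositions_def)
    fix xs
    assume "xs \<in> L"
    then show "length (c xs) = Suc k \<and> sum_list (c xs) = n"
      using count_sum[of xs]
      by (simp add: c_def L_def interv_sum_list_conv_sum_set_nat atLeast0LessThan lessThan_Suc_atMost
          del: upt_Suc)
  qed
  have fin: "finite (weak_compositions (k + 1) n)"
  proof (rule finite_subset)
    show "weak_compositions (k + 1) n \<subseteq> {ns. set ns \<subseteq> {..n} \<and> length ns = k + 1}"
      using member_le_sum_list by (fastforce simp: weak_compositions_def)
  qed (rule finite_lists_length_eq, simp)
  have fibre: "card {xs \<in> L. c xs = ns} = multinomial ns" if ns: "ns \<in> weak_compositions (k + 1) n" for ns
  proof -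
    have len: "length ns = k + 1" and sum: "sum_list ns = n"
      using ns by (auto simp: weak_compositions_def)
    have "{xs \<in> L. c xs = ns} =
      {xs. set xs \<subseteq> {..<length ns} \<and> (\<forall>i<length ns. count_list xs i = ns ! i)}"
    proof (rule Set.set_eqI)
      fix xs
      have "c xs = ns \<longleftrightarrow> (\<forall>i<length ns. count_list xs i = ns ! i)"
        using len by (auto simp: list_eq_iff_nth_eq c_def simp del: upt_Suc)
      \<comment> \<open>The multiplicities sum to n, so they force the length that \<open>L\<close>
        demands.\<close>
      moreover have "length xs = n" if "set xs \<subseteq> {..k}" "\<forall>i<length ns. count_list xs i = ns ! i"
        using count_sum[OF that(1)] that(2) len sum
        by (simp add: sum_list_sum_nth atLeast0LessThan lessThan_Suc_atMost)
      ultimately show "xs \<in> {xs \<in> L. c xs = ns} \<longleftrightarrow>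
        xs \<in> {xs. set xs \<subseteq> {..<length ns} \<and> (\<forall>i<length ns. count_list xs i = ns ! i)}"
        using len by (auto simp: L_def lessThan_Suc_atMost)
    qed
    then show ?thesis
      by (simp add: card_lists_with_counts)
  qed
  have "card (\<Union>xs\<in>L. P xs) = (\<Sum>xs\<in>L. q ^ ?w (c xs))"
    using finL finP disj cardP by (subst card_UN_disjoint) auto
  \<comment> \<open>The summand depends on \<open>xs\<close> only through \<open>c xs\<close>, so
    each fibre of \<open>c\<close> contributes its size, a multinomial coefficient, times one power
    of q.\<close>
  also have "\<dots> = (\<Sum>ns\<in>weak_compositions (k + 1) n. \<Sum>xs | xs \<in> L \<and> c xs = ns. q ^ ?w (c xs))"
    by (rule sum.group[OF finL fin c_L, symmetric])
  also have "\<dots> = (\<Sum>ns\<in>weak_compositions (k + 1) n. multinomial ns * q ^ ?w ns)"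
  proof (rule sum.cong)
    fix ns
    assume "ns \<in> weak_compositions (k + 1) n"
    then show "(\<Sum>xs | xs \<in> L \<and> c xs = ns. q ^ ?w (c xs)) = multinomial ns * q ^ ?w ns"
      by (simp add: fibre flip: fibre)
  qed simp
  finally show ?thesis
    unfolding union .
qed

end
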